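(* Let $P_1,\dots,P_k$ be (possibly unbounded) alcoved polyhedra in $\mathcal{H}_n$. Suppose $P_i$ and $P_j$ are compatible for all $i\neq j\in[k]$. Then $P_1+\dots+P_k$ is alcoved.
   Context: $\mathcal{H}_n=\{x\in\mathbb{R}^n:\sum x_i=0\}$. A (possibly unbounded) polyhedron $P\subseteq\mathcal{H}_n$ is alcoved if it is defined inside $\mathcal{H}_n$ by finitely many inequalities of the form $x_i-x_j\le a_{i,j}$ with $i\ne j$, equivalently all facet normal directions are parallel to roots $e_i-e_j$. Two alcoved polyhedra $P,Q$ are compatible if their Minkowski sum $P+Q$ is alcoved. *)

theory Defs
  imports "HOL-Analysis.Analysis" "HOL-Library.Set_Algebras"
begin

definition sum_zero_hyperplane :: "(real ^ 'n) set" where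
  "sum_zero_hyperplane = {x. (\<Sum>i\<in>UNIV. x $ i) = 0}"

text \<open>
  A triple \<open>(i, j, a)\<close> in \<open>S\<close> stands for the inequality \<open>x\<^sub>i - x\<^sub>j \<le> a\<close>.  Polyhedra may be unbounded,
  lower-dimensional or empty.
\<close>

definition alcoved :: "(real ^ 'n) set \<Rightarrow> bool" where
  "alcoved P \<longleftrightarrow>
    (\<exists>S :: ('n \<times> 'n \<times> real) set. finite S \<and> (\<forall>(i, j, a)\<in>S. i \<noteq> j) \<and>
      P = {x \<in> sum_zero_hyperplane. \<forall>(i, j, a)\<in>S. x $ i - x $ j \<le> a})"

text \<open>
  Meant for alcoved \<open>P\<close> and \<open>Q\<close>.  Addition of sets is the Minkowski sum, with neutral element
  \<open>0 = {0}\<close>.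
\<close>

definition compatible :: "(real ^ 'n) set \<Rightarrow> (real ^ 'n) set \<Rightarrow> bool" where
  "compatible P Q \<longleftrightarrow> alcoved (P + Q)"

end

theory Submission
  imports Defs
begin

text \<open>
  A nonempty closed convex set in the hyperplane is alcoved iff each of its normal cones is
  generated by the roots \<open>e\<^sub>i - e\<^sub>j\<close> it contains, and the normal cone of a Minkowski sum is the
  intersection of the normal cones of the summands.  So it suffices to show that if three closed
  convex cones \<open>A, B, C\<close> have root-generated pairwise intersections, then \<open>A \<inter> B \<inter> C\<close> is
  root-generated.

  Call \<open>w\<close> extractable from \<open>v\<close> if some \<open>v - \<epsilon> w\<close>, \<open>\<epsilon> > 0\<close>, stays in the cone.  Given \<open>v \<noteq> 0\<close> in
  \<open>A \<inter> B \<inter> C\<close>, walk alternately along roots extractable in \<open>C\<close> and in \<open>A \<inter> B\<close>, from positive to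
  negative coordinates and back.  A closed walk yields an extractable \<open>w = 1\<^sub>I - 1\<^sub>J\<close> with
  \<open>card I = card J\<close>.  When \<open>card I\<close> is minimal, every way of choosing the \<open>C\<close>-roots out of \<open>I\<close> must
  be injective; since at each \<open>i\<close> one may choose a root from \<open>B \<inter> C\<close> or one from \<open>A \<inter> C\<close>, the two
  coincide, and this common root is extractable from \<open>v\<close> in \<open>A \<inter> B \<inter> C\<close>.  A compactness argument
  then exhausts \<open>v\<close> by such roots.
\<close>

section \<open>Finitely generated cones\<close>

text \<open>The nonnegative combinations of \<open>S\<close> form a convex cone containing
  \<open>S\<close>, so by minimality the hull lies inside them.\<close>

lemma convex_cone_hull_finite_explicit:
  fixes S :: "'a::real_vector set"
  assumes "finite S" and "x \<in> convex_cone hull S"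
  obtains c where "\<And>s. s \<in> S \<Longrightarrow> 0 \<le> c s" and "x = (\<Sum>s\<in>S. c s *\<^sub>R s)"
proof -
  let ?C = "{x. \<exists>c. (\<forall>s\<in>S. 0 \<le> c s) \<and> x = (\<Sum>s\<in>S. c s *\<^sub>R s)}"
  have "convex_cone ?C"
    unfolding convex_cone_iff
  proof (intro conjI ballI allI impI)
    show "0 \<in> ?C" by (auto intro!: exI[of _ "\<lambda>_. 0"])
  next
    fix x y assume "x \<in> ?C" "y \<in> ?C"
    then obtain c d where "\<forall>s\<in>S. 0 \<le> c s" "x = (\<Sum>s\<in>S. c s *\<^sub>R s)"
      "\<forall>s\<in>S. 0 \<le> d s" "y = (\<Sum>s\<in>S. d s *\<^sub>R s)" by auto
    then show "x + y \<in> ?C"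
      by (auto intro!: exI[of _ "\<lambda>s. c s + d s"] simp: scaleR_add_left sum.distrib)
  next
    fix x and a :: real assume "x \<in> ?C" "0 \<le> a"
    then obtain c where "\<forall>s\<in>S. 0 \<le> c s" "x = (\<Sum>s\<in>S. c s *\<^sub>R s)" by auto
    with \<open>0 \<le> a\<close> show "a *\<^sub>R x \<in> ?C"
      by (auto intro!: exI[of _ "\<lambda>s. a * c s"] simp: scaleR_sum_right)
  qed
  moreover have "S \<subseteq> ?C"
  proof
    fix t assume "t \<in> S"
    have "t = (\<Sum>s\<in>S. (if s = t then 1 else 0) *\<^sub>R s)"
      using \<open>finite S\<close> \<open>t \<in> S\<close> by (simp add: if_distrib if_distribR cong: if_cong)
    then show "t \<in> ?C" by (auto intro!: exI[of _ "\<lambda>s. if s = t then 1 else 0"])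
  qed
  ultimately have "convex_cone hull S \<subseteq> ?C" by (rule hull_minimal[rotated])
  with assms(2) that show thesis by auto
qed

lemma convex_cone_sum:
  assumes "convex_cone K" and "\<And>i. i \<in> I \<Longrightarrow> f i \<in> K"
  shows "sum f I \<in> K"
  using assms(2)
  by (induction I rule: infinite_finite_induct)
    (auto simp: assms(1) convex_cone_add convex_cone_contains_0)

text \<open>Moreau decomposition: \<open>g\<close> is the point of \<open>C\<close> nearest to
  \<open>p\<close>. Testing its optimality at \<open>g + x\<close> puts \<open>p - g\<close> in the
  polar cone, and testing at \<open>0\<close> gives \<open>p - g\<close> orthogonal to
  \<open>g\<close>.\<close>

lemma closed_convex_cone_separation:
  fixes C :: "'a::euclidean_space set"
  assumes "closed C" "convex_cone C" "p \<notin> C"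
  obtains g where "g \<in> C" and "\<And>x. x \<in> C \<Longrightarrow> (p - g) \<bullet> x \<le> 0" and "0 < (p - g) \<bullet> p"
proof -
  define g where "g = closest_point C p"
  have ne: "C \<noteq> {}" using assms(2) by (rule convex_cone_nonempty)
  have gC: "g \<in> C" unfolding g_def using closest_point_in_set[OF assms(1) ne] .
  have dot: "(p - g) \<bullet> (x - g) \<le> 0" if "x \<in> C" for x
    unfolding g_def using assms that
    by (intro closest_point_dot) (auto simp: convex_cone_def)
  have "(p - g) \<bullet> ((g + x) - g) \<le> 0" if "x \<in> C" for x
    using dot[OF convex_cone_add[OF assms(2) gC that]] .
  then have le: "(p - g) \<bullet> x \<le> 0" if "x \<in> C" for x using that by simp
  have "(p - g) \<bullet> (0 - g) \<le> 0" using dot[OF convex_cone_contains_0[OF assms(2)]] .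
  then have "(p - g) \<bullet> g = 0" using le[OF gC] by simp
  then have "(p - g) \<bullet> p = (p - g) \<bullet> (p - g)" by (simp add: inner_diff_right)
  also have "\<dots> > 0" using assms(3) gC by (auto simp: inner_gt_zero_iff)
  finally show thesis using that gC le by blast
qed

text \<open>A certificate exists iff \<open>(0, -1)\<close> lies in the cone of the rows and the
  slack direction \<open>(0, 1)\<close>. Otherwise a separating functional \<open>(v, t)\<close> has
  \<open>t < 0\<close>, and rescaling \<open>v\<close> by \<open>-1/t\<close> solves the
  system.\<close>

lemma Farkas_infeasible:
  fixes G :: "('a::euclidean_space \<times> real) set"
  assumes "finite G" and infeasible: "\<nexists>x. \<forall>(g, b)\<in>G. g \<bullet> x \<le> b"
  obtains c where "\<And>h. h \<in> G \<Longrightarrow> 0 \<le> c h" and "(\<Sum>h\<in>G. c h *\<^sub>R fst h) = 0"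
    and "(\<Sum>h\<in>G. c h * snd h) < 0"
proof -
  let ?C = "convex_cone hull (insert (0, 1) G)"
  have closed: "closed ?C" using assms(1) by (intro closed_convex_cone_hull) auto
  have "(0, -1) \<in> ?C"
  proof (rule ccontr)
    assume "(0, -1) \<notin> ?C"
    then obtain g where g: "\<And>x. x \<in> ?C \<Longrightarrow> ((0, -1) - g) \<bullet> x \<le> 0" "0 < ((0, -1) - g) \<bullet> (0, -1)"
      using closed_convex_cone_separation[OF closed convex_cone_convex_cone_hull] by metis
    obtain v t where vt: "(0, -1) - g = (v, t)" by fastforce
    have t: "t < 0" using g(2) unfolding vt by simp
    have "h \<bullet> ((-1/t) *\<^sub>R v) \<le> b" if "(h, b) \<in> G" for h b
    proof -
      have "(h, b) \<in> ?C" using that by (simp add: hull_inc)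
      from g(1)[OF this] have "v \<bullet> h + t * b \<le> 0" unfolding vt by simp
      then show ?thesis using t by (simp add: field_simps inner_commute)
    qed
    with infeasible show False by blast
  qed
  then obtain c where c: "\<And>s. s \<in> insert (0, 1) G \<Longrightarrow> 0 \<le> c s"
    and eq: "(0, -1) = (\<Sum>s\<in>insert (0, 1) G. c s *\<^sub>R s)"
    using convex_cone_hull_finite_explicit[of "insert (0, 1) G" "(0, -1)"] assms(1) by auto
  have "fst (0::'a, -1::real) = (\<Sum>s\<in>insert (0, 1) G. c s *\<^sub>R fst s)"
    by (subst eq) (simp add: fst_sum)
  then have 1: "(\<Sum>s\<in>G. c s *\<^sub>R fst s) = 0"
    using assms(1) by (cases "(0, 1) \<in> G") (auto simp: insert_absorb)
  have "snd (0::'a, -1::real) = (\<Sum>s\<in>insert (0, 1) G. c s * snd s)"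
    by (subst eq) (simp add: snd_sum)
  \<comment> \<open>Dropping the nonnegative weight of \<open>(0, 1)\<close> leaves a sum of at most
    \<open>- 1\<close>.\<close>
  then have 2: "(\<Sum>s\<in>G. c s * snd s) < 0"
    using assms(1) c[of "(0, 1)"] by (cases "(0, 1) \<in> G") (auto simp: insert_absorb)
  from that[OF _ 1 2] c show thesis by simp
qed

text \<open>If \<open>y\<close> is outside the sum, a Farkas certificate refutes the system
  \<open>x \<in> S\<close>, \<open>y - x \<in> T\<close> with a fixed gap \<open>d\<close>. A point
  of the sum very close to \<open>y\<close> would violate that system by less than the gap
  allows.\<close>

lemma closed_sum_finite_halfspaces:
  fixes S T :: "'a::euclidean_space set"
  assumes "finite F" "S = {x. \<forall>(g, b)\<in>F. g \<bullet> x \<le> b}"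
    and "finite G" "T = {x. \<forall>(g, b)\<in>G. g \<bullet> x \<le> b}"
  shows "closed (S + T)"
proof -
  have "y \<in> S + T" if y: "y \<in> closure (S + T)" for y
  proof (rule ccontr)
    assume notin: "y \<notin> S + T"
    \<comment> \<open>The constraints of \<open>S\<close> on \<open>x\<close>, together with those
      of \<open>T\<close> on \<open>y - x\<close> rewritten as constraints on
      \<open>x\<close>.\<close>
    define H where "H = F \<union> (\<lambda>(g, b). (- g, b - g \<bullet> y)) ` G"
    have finite: "finite H" using assms by (simp add: H_def)
    have "\<nexists>x. \<forall>(g, b)\<in>H. g \<bullet> x \<le> b"
    proof
      assume "\<exists>x. \<forall>(g, b)\<in>H. g \<bullet> x \<le> b"
      then obtain x where x: "\<forall>(g, b)\<in>H. g \<bullet> x \<le> b" ..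
      have "x \<in> S" using x by (auto simp: H_def assms(2))
      moreover have "y - x \<in> T"
      proof -
        have "g \<bullet> (y - x) \<le> b" if "(g, b) \<in> G" for g b
        proof -
          have "(- g, b - g \<bullet> y) \<in> H" using that by (force simp: H_def)
          with x have "(- g) \<bullet> x \<le> b - g \<bullet> y" by blast
          then show ?thesis by (simp add: inner_diff_right)
        qed
        then show ?thesis by (auto simp: assms(4))
      qed
      ultimately have "x + (y - x) \<in> S + T" by (rule set_plus_intro)
      with notin show False by simp
    qed
    from Farkas_infeasible[OF finite this] obtain c
      where c: "\<And>h. h \<in> H \<Longrightarrow> 0 \<le> c h" "(\<Sum>h\<in>H. c h *\<^sub>R fst h) = 0"
      "(\<Sum>h\<in>H. c h * snd h) < 0"
      by blast
    define M where "M = (\<Sum>h\<in>H. c h * norm (fst h))"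
    define d where "d = - (\<Sum>h\<in>H. c h * snd h)"
    have M: "0 \<le> M" unfolding M_def using c(1) by (intro sum_nonneg) auto
    have d: "0 < d" using c(3) by (simp add: d_def)
    \<comment> \<open>The \<open>+ 1\<close> keeps the denominator positive even if
      \<open>M = 0\<close>.\<close>
    then have "0 < d / (M + 1)" using M by simp
    then obtain z where z: "z \<in> S + T" "dist z y < d / (M + 1)"
      using y unfolding closure_approachable by blast
    then obtain s t where st: "s \<in> S" "t \<in> T" "z = s + t" by (auto elim: set_plus_elim)
    \<comment> \<open>\<open>s\<close> satisfies \<open>H\<close> up to an error from replacing
      \<open>y\<close> by \<open>z = s + t\<close>; only the constraints coming from
      \<open>T\<close> feel it.\<close>
    have lower: "- (norm (fst h) * norm (z - y)) \<le> snd h - fst h \<bullet> s" if "h \<in> H" for h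
      using that unfolding H_def
    proof
      assume "h \<in> F"
      then have "fst h \<bullet> s \<le> snd h" using st(1) by (auto simp: assms(2))
      moreover have "0 \<le> norm (fst h) * norm (z - y)" by simp
      ultimately show ?thesis by linarith
    next
      assume "h \<in> (\<lambda>(g, b). (- g, b - g \<bullet> y)) ` G"
      then obtain g b where gb: "(g, b) \<in> G" "h = (- g, b - g \<bullet> y)" by auto
      have "g \<bullet> t \<le> b" using gb(1) st(2) by (auto simp: assms(4))
      moreover have "- (norm g * norm (z - y)) \<le> g \<bullet> (z - y)"
        using Cauchy_Schwarz_ineq2[of g "z - y"] by linarith
      ultimately show ?thesis by (simp add: gb(2) st(3) inner_diff_right inner_add_right)
    qed
    have "- (M * norm (z - y)) = (\<Sum>h\<in>H. c h * - (norm (fst h) * norm (z - y)))"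
      by (simp add: M_def sum_distrib_right sum_negf mult.assoc)
    also have "\<dots> \<le> (\<Sum>h\<in>H. c h * (snd h - fst h \<bullet> s))"
      using lower c(1) by (intro sum_mono mult_left_mono) auto
    also have "\<dots> = (\<Sum>h\<in>H. c h * snd h) - (\<Sum>h\<in>H. c h *\<^sub>R fst h) \<bullet> s"
      by (simp add: right_diff_distrib sum_subtractf inner_sum_left)
    finally have "d \<le> M * norm (z - y)" using c(2) by (simp add: d_def)
    also have "\<dots> \<le> (M + 1) * norm (z - y)" by (intro mult_right_mono) auto
    also have "\<dots> < d" using z(2) M by (simp add: dist_norm field_simps)
    finally show False by simp
  qed
  then show ?thesis using closure_subset_eq by blast
qed

section \<open>Cones generated by roots\<close>

definition root_vec :: "'n \<Rightarrow> 'n \<Rightarrow> real ^ 'n" where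
  "root_vec i j = axis i 1 - axis j 1"

text \<open>Pairs with \<open>i = j\<close> are allowed, so \<open>0\<close> is included; this
  leaves convex cone hulls unchanged and avoids distinctness conditions.\<close>

definition roots :: "(real ^ 'n) set" where
  "roots = {root_vec i j |i j. True}"

text \<open>For a convex cone the reverse inclusion is automatic.\<close>

definition root_generated :: "(real ^ 'n) set \<Rightarrow> bool" where
  "root_generated K \<longleftrightarrow> K \<subseteq> convex_cone hull (K \<inter> roots)"

text \<open>For a convex cone \<open>K\<close> containing \<open>v\<close>, the intersection of this
  set with \<open>K\<close> is the smallest face of \<open>K\<close> containing
  \<open>v\<close>.\<close>

definition extractable :: "'a::real_vector set \<Rightarrow> 'a \<Rightarrow> 'a set" where
  "extractable K v = {w. \<exists>\<epsilon>>0. v - \<epsilon> *\<^sub>R w \<in> K}"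

lemma inner_root_vec [simp]: "x \<bullet> root_vec i j = x $ i - x $ j"
  by (simp add: root_vec_def inner_diff_right inner_axis)

lemma root_vec_refl [simp]: "root_vec i i = 0"
  by (simp add: root_vec_def)

lemma root_vec_trans: "root_vec i j + root_vec j k = root_vec i k"
  by (simp add: root_vec_def)

lemma minus_root_vec: "- root_vec i j = root_vec j i"
  by (simp add: root_vec_def)

lemma root_vec_nth: "root_vec i j $ k = (if k = i then 1 else 0) - (if k = j then 1 else 0)"
  by (simp add: root_vec_def axis_def)

lemma finite_roots [simp]: "finite (roots :: (real ^ 'n) set)"
proof -
  have "roots = range (\<lambda>(i, j). root_vec i j :: real ^ 'n)" by (auto simp: roots_def)
  then show ?thesis using finite_imageI[OF finite] by metis
qed

lemma root_vec_in_roots [simp]: "root_vec i j \<in> roots"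
  unfolding roots_def by blast

lemma uminus_roots: "uminus ` roots = (roots :: (real ^ 'n) set)"
proof -
  have "- r \<in> roots" if "r \<in> roots" for r :: "real ^ 'n"
  proof -
    have "\<exists>i j. r = root_vec i j" using that by (simp add: roots_def)
    then show ?thesis by (auto simp: minus_root_vec)
  qed
  then show ?thesis by (metis image_subsetI subset_antisym minus_minus image_eqI subsetI)
qed

lemma convex_cone_Int: "convex_cone A \<Longrightarrow> convex_cone B \<Longrightarrow> convex_cone (A \<inter> B)"
  by (simp add: convex_cone_iff)

text \<open>The two witnesses are averaged with weights that give \<open>w\<close> and
  \<open>w'\<close> the same coefficient.\<close>

lemma extractable_add:
  assumes "convex_cone K" "w \<in> extractable K v" "w' \<in> extractable K v"
  shows "w + w' \<in> extractable K v"
proof -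
  obtain a b where ab: "a > 0" "v - a *\<^sub>R w \<in> K" "b > 0" "v - b *\<^sub>R w' \<in> K"
    using assms by (auto simp: extractable_def)
  let ?c = "a * b / (a + b)"
  have "(b / (a + b)) *\<^sub>R (v - a *\<^sub>R w) + (a / (a + b)) *\<^sub>R (v - b *\<^sub>R w')
      = (b / (a + b) + a / (a + b)) *\<^sub>R v - ?c *\<^sub>R (w + w')"
    by (simp add: algebra_simps)
  also have "b / (a + b) + a / (a + b) = 1"
    using ab by (simp add: add_divide_distrib[symmetric])
  finally have "v - ?c *\<^sub>R (w + w')
      = (b / (a + b)) *\<^sub>R (v - a *\<^sub>R w) + (a / (a + b)) *\<^sub>R (v - b *\<^sub>R w')" by simp
  moreover have "\<dots> \<in> K"
    using ab by (intro convex_cone_add[OF assms(1)] convex_cone_scaleR[OF assms(1)]) auto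
  moreover have "?c > 0" using ab by simp
  ultimately show ?thesis unfolding extractable_def by (metis (no_types, lifting) mem_Collect_eq)
qed

lemma extractable_shrink:
  assumes "convex_cone K" "v \<in> K" "v - \<epsilon> *\<^sub>R w \<in> K" "0 \<le> \<delta>" "\<delta> \<le> \<epsilon>"
  shows "v - \<delta> *\<^sub>R w \<in> K"
proof (cases "\<epsilon> = 0")
  case True
  with assms show ?thesis by simp
next
  case False
  then have "v - \<delta> *\<^sub>R w = (1 - \<delta> / \<epsilon>) *\<^sub>R v + (\<delta> / \<epsilon>) *\<^sub>R (v - \<epsilon> *\<^sub>R w)"
    by (simp add: algebra_simps)
  also have "\<dots> \<in> K"
    using assms False by (intro convex_cone_add[OF assms(1)] convex_cone_scaleR[OF assms(1)]) auto
  finally show ?thesis .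
qed

lemma extractable_0: "v \<in> K \<Longrightarrow> 0 \<in> extractable K v"
  by (auto simp: extractable_def intro: exI[of _ 1])

lemma extractable_sum:
  assumes "convex_cone K" "v \<in> K" "\<And>i. i \<in> I \<Longrightarrow> f i \<in> extractable K v"
  shows "sum f I \<in> extractable K v"
  using assms(3)
  by (induction I rule: infinite_finite_induct)
    (auto simp: extractable_0 assms(2) intro: extractable_add[OF assms(1)])

lemma extractable_Int:
  assumes "convex_cone A" "convex_cone B" "v \<in> A" "v \<in> B"
  shows "extractable (A \<inter> B) v = extractable A v \<inter> extractable B v"
proof (intro equalityI subsetI)
  fix w assume "w \<in> extractable A v \<inter> extractable B v"
  then obtain a b where ab: "a > 0" "v - a *\<^sub>R w \<in> A" "b > 0" "v - b *\<^sub>R w \<in> B"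
    by (auto simp: extractable_def)
  have "v - min a b *\<^sub>R w \<in> A" "v - min a b *\<^sub>R w \<in> B"
    using ab assms by (auto intro: extractable_shrink[of _ _ a] extractable_shrink[of _ _ b])
  then show "w \<in> extractable (A \<inter> B) v"
    using ab unfolding extractable_def by (auto intro!: exI[of _ "min a b"])
qed (auto simp: extractable_def)

text \<open>This allows roots to be extracted from an auxiliary vector \<open>w\<close> instead of
  from \<open>v\<close> itself.\<close>

lemma extractable_trans:
  assumes "convex_cone K" "w \<in> extractable K v" "w' \<in> extractable K w"
  shows "w' \<in> extractable K v"
proof -
  obtain a b where ab: "a > 0" "v - a *\<^sub>R w \<in> K" "b > 0" "w - b *\<^sub>R w' \<in> K"
    using assms by (auto simp: extractable_def)
  have "v - (a * b) *\<^sub>R w' = (v - a *\<^sub>R w) + a *\<^sub>R (w - b *\<^sub>R w')"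
    by (simp add: algebra_simps)
  also have "\<dots> \<in> K"
    using ab by (intro convex_cone_add[OF assms(1)] convex_cone_scaleR[OF assms(1)]) auto
  finally show ?thesis using ab unfolding extractable_def by (auto intro!: exI[of _ "a * b"])
qed

text \<open>
  The vertices \<open>j\<close> for which \<open>root_vec i j\<close> can be extracted are closed under
  following the edges of any root decomposition of \<open>v\<close>, so no flow leaves this set and
  it must contain a sink.
\<close>

lemma root_generated_source:
  fixes K :: "(real ^ 'n) set"
  assumes K: "convex_cone K" "root_generated K" and v: "v \<in> K" "0 < v $ i"
  obtains j where "v $ j < 0" "root_vec i j \<in> K" "root_vec i j \<in> extractable K v"
proof -
  define D where "D = K \<inter> roots"
  have "finite D" by (simp add: D_def)
  have "v \<in> convex_cone hull D" using K v by (auto simp: root_generated_def D_def)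
  from convex_cone_hull_finite_explicit[OF \<open>finite D\<close> this] obtain c
    where c: "\<And>r. r \<in> D \<Longrightarrow> 0 \<le> c r" and v_eq: "v = (\<Sum>r\<in>D. c r *\<^sub>R r)"
    by blast
  define R where "R = {j. root_vec i j \<in> K \<inter> extractable K v}"
  define \<chi>R :: "real ^ 'n" where "\<chi>R = (\<chi> j. if j \<in> R then 1 else 0)"
  have "i \<in> R"
    using extractable_0[OF v(1)] by (simp add: R_def convex_cone_contains_0[OF K(1)])
  \<comment> \<open>The pairing of \<open>\<chi>R\<close> with \<open>root_vec k l\<close> is
    positive only if the edge from \<open>k\<close> to \<open>l\<close> leaves
    \<open>R\<close>.\<close>
  have step: "\<chi>R \<bullet> r \<le> 0" if "r \<in> D" "c r > 0" for r
  proof -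
    obtain k l where r: "r = root_vec k l" using \<open>r \<in> D\<close> by (auto simp: D_def roots_def)
    \<comment> \<open>Removing one summand leaves a combination of elements of \<open>K\<close>, so
      the coefficient \<open>c r\<close> witnesses extractability.\<close>
    have "v - c r *\<^sub>R r = (\<Sum>r\<in>D - {r}. c r *\<^sub>R r)"
      using v_eq \<open>finite D\<close> that(1) by (simp add: sum_diff1)
    also have "\<dots> \<in> K"
      using c by (intro convex_cone_sum[OF K(1)] convex_cone_scaleR[OF K(1)]) (auto simp: D_def)
    finally have "r \<in> extractable K v" using that(2) by (auto simp: extractable_def)
    moreover have "r \<in> K" using that(1) by (simp add: D_def)
    ultimately have "l \<in> R" if "k \<in> R"
      using that extractable_add[OF K(1), of "root_vec i k" v r]
        convex_cone_add[OF K(1), of "root_vec i k" r]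
      by (simp add: R_def r root_vec_trans)
    then show ?thesis by (auto simp: r \<chi>R_def)
  qed
  have "(\<Sum>j\<in>R. v $ j) = \<chi>R \<bullet> v"
    by (simp add: inner_vec_def \<chi>R_def if_distrib if_distribR sum.If_cases cong: if_cong)
  also have "\<dots> = (\<Sum>r\<in>D. c r * (\<chi>R \<bullet> r))"
    by (subst v_eq) (simp add: inner_sum_right)
  also have "\<dots> \<le> 0"
  proof (rule sum_nonpos)
    fix r assume "r \<in> D"
    then show "c r * (\<chi>R \<bullet> r) \<le> 0"
      using c[of r] step[of r] by (cases "c r = 0") (auto intro: mult_nonneg_nonpos)
  qed
  finally have "\<not> (\<forall>j\<in>R. 0 \<le> v $ j)"
    using sum_pos2[of R i "\<lambda>j. v $ j"] \<open>i \<in> R\<close> v(2) by fastforce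
  then show thesis using that by (auto simp: R_def not_le)
qed

lemma root_generated_uminus:
  fixes K :: "(real ^ 'n) set"
  assumes "root_generated K"
  shows "root_generated (uminus ` K)"
proof -
  have "uminus ` K \<subseteq> uminus ` (convex_cone hull (K \<inter> roots))"
    using assms by (auto simp: root_generated_def)
  also have "\<dots> = convex_cone hull (uminus ` (K \<inter> roots))"
    by (rule convex_cone_hull_linear_image[symmetric]) (simp add: linear_uminus)
  also have "uminus ` (K \<inter> roots) = uminus ` K \<inter> roots"
    by (subst image_Int) (simp_all add: uminus_roots)
  finally show ?thesis by (simp add: root_generated_def)
qed

text \<open>The mirror image of \<open>root_generated_source\<close>: negating the cone and
  \<open>v\<close> swaps signs of coordinates and reverses every root.\<close>

lemma root_generated_sink:
  fixes K :: "(real ^ 'n) set"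
  assumes K: "convex_cone K" "root_generated K" and v: "v \<in> K" "v $ j < 0"
  obtains i where "0 < v $ i" "root_vec i j \<in> K" "root_vec i j \<in> extractable K v"
proof -
  have "convex_cone (uminus ` K)" using K by (simp add: convex_cone_linear_image linear_uminus)
  moreover have "- v \<in> uminus ` K" "0 < (- v) $ j" using v by auto
  ultimately obtain i where i: "(- v) $ i < 0" "root_vec j i \<in> uminus ` K"
    "root_vec j i \<in> extractable (uminus ` K) (- v)"
    using root_generated_source[OF _ root_generated_uminus[OF K(2)]] by metis
  then have "root_vec i j \<in> K" by (metis imageE minus_minus minus_root_vec)
  moreover have "root_vec i j \<in> extractable K v"
  proof -
    obtain \<epsilon> where e: "\<epsilon> > 0" "- v - \<epsilon> *\<^sub>R root_vec j i \<in> uminus ` K"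
      using i(3) by (auto simp: extractable_def)
    then have "- (- v - \<epsilon> *\<^sub>R root_vec j i) \<in> K" by (metis imageE minus_minus)
    moreover have "- (- v - \<epsilon> *\<^sub>R root_vec j i) = v - \<epsilon> *\<^sub>R root_vec i j"
      by (simp add: minus_root_vec[of i j, symmetric])
    ultimately show ?thesis using e(1) by (auto simp: extractable_def)
  qed
  ultimately show thesis using that i(1) by simp
qed

section \<open>Closed walks and common roots\<close>

lemma self_map_invariant_subset:
  assumes "finite X" "X \<noteq> {}" "g ` X \<subseteq> X"
  obtains I where "I \<subseteq> X" "I \<noteq> {}" "g ` I = I"
proof -
  \<comment> \<open>An invariant set of least size stands in for a cycle found by iterating
    \<open>g\<close>: its image is again invariant, hence not smaller.\<close>
  define good where "good I \<longleftrightarrow> I \<subseteq> X \<and> I \<noteq> {} \<and> g ` I \<subseteq> I" for I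
  have "good X" using assms by (simp add: good_def)
  then obtain I where I: "good I" and min: "\<And>J. good J \<Longrightarrow> card I \<le> card J"
    using ex_has_least_nat[of good X card] by blast
  have fin: "finite I" using I assms(1) by (auto simp: good_def intro: finite_subset)
  have "good (g ` I)" using I by (auto simp: good_def)
  from min[OF this] have "g ` I = I"
    using I fin by (intro card_seteq) (auto simp: good_def)
  with I that show thesis by (auto simp: good_def)
qed

definition difference_vec :: "'n set \<Rightarrow> 'n set \<Rightarrow> real ^ 'n" where
  "difference_vec I J = (\<chi> k. (if k \<in> I then 1 else 0) - (if k \<in> J then 1 else 0))"

text \<open>Injectivity makes each start and each end occur exactly once, so the sum depends only on
  the two image sets. Hence different pairings of the same sets give the same vector.\<close>

lemma sum_root_vec:
  fixes s t :: "'a \<Rightarrow> 'n::finite"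
  assumes "finite X" "inj_on s X" "inj_on t X"
  shows "(\<Sum>x\<in>X. root_vec (s x) (t x)) = difference_vec (s ` X) (t ` X)"
proof -
  have aux: "(\<Sum>x\<in>X. if k = f x then 1 else 0) = (if k \<in> f ` X then 1 else 0 :: real)"
    if "inj_on f X" for k and f :: "'a \<Rightarrow> 'n"
  proof -
    have "(\<Sum>x\<in>X. if k = f x then 1 else 0 :: real) = (\<Sum>y\<in>f ` X. if k = y then 1 else 0)"
      by (subst sum.reindex[OF that]) simp
    also have "\<dots> = (if k \<in> f ` X then 1 else 0)" using assms(1) by simp
    finally show ?thesis .
  qed
  show ?thesis
    by (simp add: vec_eq_iff difference_vec_def root_vec_nth sum_subtractf aux assms)
qed

text \<open>
  Alternately following \<open>r\<close> and \<open>s\<close> closes up, and the resulting vector is a sum of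
  roots \<open>root_vec i (r i)\<close> and also a sum of roots \<open>root_vec (s j) j\<close>.
\<close>

lemma alternating_cycle:
  fixes A B :: "(real ^ 'n) set"
  assumes cones: "convex_cone A" "convex_cone B" and v: "v \<in> A" "v \<in> B" "0 < v $ i0"
    and r: "\<And>i. 0 < v $ i \<Longrightarrow> v $ r i < 0"
      "\<And>i. 0 < v $ i \<Longrightarrow> root_vec i (r i) \<in> A \<inter> extractable A v"
    and s: "\<And>j. v $ j < 0 \<Longrightarrow> 0 < v $ s j"
      "\<And>j. v $ j < 0 \<Longrightarrow> root_vec (s j) j \<in> B \<inter> extractable B v"
  obtains I where "I \<noteq> {}" "I \<subseteq> {i. 0 < v $ i}" "inj_on r I"
    "difference_vec I (r ` I) \<in> A \<inter> B \<inter> extractable (A \<inter> B) v"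
proof -
  obtain I where I: "I \<subseteq> {i. 0 < v $ i}" "I \<noteq> {}" "(s \<circ> r) ` I = I"
  proof (rule self_map_invariant_subset)
    show "(s \<circ> r) ` {i. 0 < v $ i} \<subseteq> {i. 0 < v $ i}" by (auto intro: r(1) s(1))
  qed (use v(3) in auto)
  have neg: "v $ j < 0" if "j \<in> r ` I" for j using that I(1) r(1) by blast
  have inj: "inj_on (s \<circ> r) I" by (rule eq_card_imp_inj_on) (simp, simp only: I(3))
  have injr: "inj_on r I" using inj by (rule inj_on_imageI2)
  have injs: "inj_on s (r ` I)" using inj by (rule inj_on_imageI)
  have "difference_vec I (r ` I) = (\<Sum>i\<in>I. root_vec i (r i))"
    using sum_root_vec[of I id r] injr by simp
  moreover have "(\<Sum>i\<in>I. root_vec i (r i)) \<in> A"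
    using I(1) r(2) by (intro convex_cone_sum[OF cones(1)]) blast
  moreover have "(\<Sum>i\<in>I. root_vec i (r i)) \<in> extractable A v"
    using I(1) r(2) by (intro extractable_sum[OF cones(1) v(1)]) blast
  ultimately have 1: "difference_vec I (r ` I) \<in> A \<inter> extractable A v" by simp
  \<comment> \<open>The starting points \<open>s j\<close> run over \<open>I\<close> again because
    \<open>s \<circ> r\<close> maps \<open>I\<close> onto itself.\<close>
  have "difference_vec I (r ` I) = (\<Sum>j\<in>r ` I. root_vec (s j) j)"
    using sum_root_vec[of "r ` I" s id] injs I(3) by (simp add: image_comp)
  moreover have "(\<Sum>j\<in>r ` I. root_vec (s j) j) \<in> B"
    using neg s(2) by (intro convex_cone_sum[OF cones(2)]) blast
  moreover have "(\<Sum>j\<in>r ` I. root_vec (s j) j) \<in> extractable B v"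
    using neg s(2) by (intro extractable_sum[OF cones(2) v(2)]) blast
  ultimately have "difference_vec I (r ` I) \<in> B \<inter> extractable B v" by simp
  with 1 have "difference_vec I (r ` I) \<in> A \<inter> B \<inter> extractable (A \<inter> B) v"
    using extractable_Int[OF cones v(1,2)] by blast
  with that I injr show thesis by blast
qed

text \<open>\<open>A \<inter> B\<close> supplies the roots leading back to positive coordinates,
  while \<open>B \<inter> C\<close> and \<open>A \<inter> C\<close> supply two competing choices of
  \<open>C\<close>-roots leaving them.\<close>

lemma common_root_extractable:
  fixes A B C :: "(real ^ 'n) set"
  assumes cones: "convex_cone A" "convex_cone B" "convex_cone C"
    and gen: "root_generated (A \<inter> B)" "root_generated (B \<inter> C)" "root_generated (A \<inter> C)"
    and v: "v \<in> A \<inter> B \<inter> C" "0 < v $ i0"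
  obtains i j where "0 < v $ i" "v $ j < 0"
    "root_vec i j \<in> A \<inter> B \<inter> C" "root_vec i j \<in> extractable (A \<inter> B \<inter> C) v"
proof -
  let ?K = "A \<inter> B \<inter> C"
  note AB = convex_cone_Int[OF cones(1,2)] and BC = convex_cone_Int[OF cones(2,3)]
    and AC = convex_cone_Int[OF cones(1,3)]
  have K: "convex_cone ?K" using convex_cone_Int[OF AB cones(3)] .
  have ext_K: "extractable ?K w = extractable A w \<inter> extractable B w \<inter> extractable C w"
    if "w \<in> ?K" for w
    using that cones AB by (simp add: extractable_Int)
  define edge where "edge L w i j \<longleftrightarrow> 0 < w $ i \<and> w $ j < 0 \<and> root_vec i j \<in> L \<inter> extractable L w"
    for L and w :: "real ^ 'n" and i j
  have source: "\<exists>y. \<forall>i. 0 < w $ i \<longrightarrow> edge L w i (y i)"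
    if "convex_cone L" "root_generated L" "w \<in> L" for L w
    unfolding edge_def using root_generated_source[OF that] by (intro choice) blast
  have sink: "\<exists>s. \<forall>j. w $ j < 0 \<longrightarrow> edge L w (s j) j"
    if "convex_cone L" "root_generated L" "w \<in> L" for L w
    unfolding edge_def using root_generated_sink[OF that] by (intro choice) blast
  have edge_mono: "edge M w i j" if "edge L w i j" "L \<subseteq> M" for L M w i j
    using that by (auto simp: edge_def extractable_def)
  \<comment> \<open>Stated for arbitrary \<open>w\<close>: at \<open>v\<close> it shows that a good
    set exists, at the minimal vector it forces injectivity.\<close>
  have cycle: "\<exists>I. I \<noteq> {} \<and> I \<subseteq> {i. 0 < w $ i} \<and> r ` I \<subseteq> {j. w $ j < 0} \<and> inj_on r I \<and>
      difference_vec I (r ` I) \<in> ?K \<inter> extractable ?K w"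
    if w: "w \<in> ?K" "0 < w $ i" and r: "\<And>i. 0 < w $ i \<Longrightarrow> edge C w i (r i)" for w i r
  proof -
    obtain s where s: "\<And>j. w $ j < 0 \<Longrightarrow> edge (A \<inter> B) w (s j) j"
      using sink[OF AB gen(1)] w by blast
    obtain I where I: "I \<noteq> {}" "I \<subseteq> {i. 0 < w $ i}" "inj_on r I"
      "difference_vec I (r ` I) \<in> C \<inter> (A \<inter> B) \<inter> extractable (C \<inter> (A \<inter> B)) w"
      by (rule alternating_cycle[OF cones(3) AB, of w i r s]) (use w r s in \<open>unfold edge_def, blast+\<close>)
    moreover have "C \<inter> (A \<inter> B) = ?K" by blast
    moreover have "r ` I \<subseteq> {j. w $ j < 0}" using I(2) r by (auto simp: edge_def)
    ultimately show ?thesis by metis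
  qed
  \<comment> \<open>The equal cardinalities later turn an injection from \<open>I\<close> into
    \<open>J\<close> into a bijection.\<close>
  define good where "good I \<longleftrightarrow> I \<noteq> {} \<and> I \<subseteq> {i. 0 < v $ i} \<and>
    (\<exists>J \<subseteq> {j. v $ j < 0}. card J = card I \<and> difference_vec I J \<in> ?K \<inter> extractable ?K v)" for I
  obtain y0 where "\<And>i. 0 < v $ i \<Longrightarrow> edge (B \<inter> C) v i (y0 i)"
    using source[OF BC gen(2)] v(1) by blast
  then have "\<And>i. 0 < v $ i \<Longrightarrow> edge C v i (y0 i)" using edge_mono by blast
  from cycle[OF v this] have "\<exists>I. good I"
    unfolding good_def using card_image by metis
  then obtain I where I: "good I" and min: "\<And>I'. good I' \<Longrightarrow> card I \<le> card I'"
    using ex_has_least_nat[of good _ card] by blast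
  then obtain J where J: "J \<subseteq> {j. v $ j < 0}" "card J = card I"
      "difference_vec I J \<in> ?K" "difference_vec I J \<in> extractable ?K v"
    and Iv: "I \<noteq> {}" "I \<subseteq> {i. 0 < v $ i}"
    by (auto simp: good_def)
  define w where "w = difference_vec I J"
  have wK: "w \<in> ?K" "w \<in> extractable ?K v" using J by (simp_all add: w_def)
  have "I \<inter> J = {}" using Iv J(1) by force
  then have w_pos: "0 < w $ k \<longleftrightarrow> k \<in> I" and w_neg: "w $ k < 0 \<longleftrightarrow> k \<in> J" for k
    by (auto simp: w_def difference_vec_def)
  obtain i where i: "i \<in> I" using Iv by blast
  \<comment> \<open>Whatever is extractable from \<open>w\<close> is extractable from
    \<open>v\<close>, so a cycle on a proper subset of \<open>I\<close> would contradict
    minimality.\<close>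
  have inj: "inj_on r I" if r: "\<And>i. 0 < w $ i \<Longrightarrow> edge C w i (r i)" for r
  proof -
    obtain I' where I': "I' \<noteq> {}" "I' \<subseteq> I" "r ` I' \<subseteq> J" "inj_on r I'"
      "difference_vec I' (r ` I') \<in> ?K \<inter> extractable ?K w"
      using cycle[OF wK(1), of i r] r i by (auto simp: w_pos w_neg)
    have "good I'" unfolding good_def
    proof (intro conjI exI[of _ "r ` I'"])
      show "difference_vec I' (r ` I') \<in> ?K \<inter> extractable ?K v"
        using I'(5) extractable_trans[OF K wK(2)] by blast
    qed (use I' Iv J(1) in \<open>auto simp: card_image\<close>)
    then have "I' = I" using min I'(2) by (intro card_seteq) auto
    with I'(4) show ?thesis by simp
  qed
  obtain y where y: "\<And>i. 0 < w $ i \<Longrightarrow> edge (B \<inter> C) w i (y i)"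
    using source[OF BC gen(2)] wK(1) by blast
  obtain z where z: "\<And>i. 0 < w $ i \<Longrightarrow> edge (A \<inter> C) w i (z i)"
    using source[OF AC gen(3)] wK(1) by blast
  have yC: "edge C w k (y k)" if "0 < w $ k" for k using edge_mono[OF y[OF that]] by simp
  have zC: "edge C w k (z k)" if "0 < w $ k" for k using edge_mono[OF z[OF that]] by simp
  have "inj_on y I" using yC by (rule inj)
  moreover have "y ` I \<subseteq> J" using y by (auto simp: edge_def w_pos w_neg)
  ultimately have "y ` I = J" using J(2) by (intro card_subset_eq) (auto simp: card_image)
  moreover have "z i \<in> J" using z[of i] i by (auto simp: edge_def w_pos w_neg)
  ultimately obtain k where k: "k \<in> I" "z i = y k" by auto
  \<comment> \<open>Switching the choice at \<open>i\<close> alone is still a valid choice of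
    \<open>C\<close>-roots; its new value \<open>z i = y k\<close> would collide with the value at
    \<open>k\<close> unless \<open>k = i\<close>.\<close>
  have "inj_on (y(i := z i)) I" using yC zC by (intro inj) auto
  then have "k = i" using i k unfolding inj_on_def by (metis fun_upd_apply)
  then have "edge (B \<inter> C) w i (y i)" "edge (A \<inter> C) w i (y i)" using y z i k(2) w_pos by metis+
  then have *: "root_vec i (y i) \<in> ?K" "root_vec i (y i) \<in> extractable ?K w"
    using wK(1) cones by (auto simp: edge_def ext_K extractable_Int)
  show thesis
  proof (rule that)
    show "0 < v $ i" "v $ y i < 0" using i Iv \<open>y ` I \<subseteq> J\<close> J(1) by auto
    show "root_vec i (y i) \<in> extractable ?K v" using extractable_trans[OF K wK(2) *(2)] .
  qed (rule *(1))
qed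

section \<open>Triple intersections of root-generated cones\<close>

lemma sum_zero_hyperplane_pos_entry:
  assumes "v \<in> sum_zero_hyperplane" "v \<noteq> 0"
  obtains i where "0 < v $ i"
proof (rule ccontr)
  assume "\<not> thesis"
  then have "\<forall>i. 0 \<le> - v $ i" using that by (meson neg_0_le_iff_le not_le)
  moreover have "(\<Sum>i\<in>UNIV. - v $ i) = 0"
    using assms(1) by (simp add: sum_zero_hyperplane_def sum_negf)
  ultimately have "\<forall>i. v $ i = 0" by (simp add: sum_nonneg_eq_0_iff)
  with assms(2) show False by (simp add: vec_eq_iff)
qed

text \<open>Among the remainders of \<open>u\<close> after subtracting combinations of roots in the
  cone, one minimizing the inner product with \<open>u\<close> must vanish, since otherwise another
  root could be extracted.\<close>

lemma root_generated_Int3: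
  fixes A B C :: "(real ^ 'n) set"
  assumes cones: "convex_cone A" "convex_cone B" "convex_cone C"
    and closed: "closed A" "closed B" "closed C"
    and sub: "A \<subseteq> sum_zero_hyperplane"
    and gen: "root_generated (A \<inter> B)" "root_generated (B \<inter> C)" "root_generated (A \<inter> C)"
  shows "root_generated (A \<inter> B \<inter> C)"
  unfolding root_generated_def
proof
  let ?K = "A \<inter> B \<inter> C"
  let ?G = "convex_cone hull (?K \<inter> roots)"
  have K: "convex_cone ?K" using cones by (intro convex_cone_Int)
  fix u assume u: "u \<in> ?K"
  \<comment> \<open>The box keeps each coordinate of a remainder between \<open>0\<close> and that
    of \<open>u\<close>, which gives compactness and preserves signs.\<close>
  define X where "X = cbox (\<chi> i. min 0 (u $ i)) (\<chi> i. max 0 (u $ i)) \<inter> (?K \<inter> (\<lambda>v. u - v) -` ?G)"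
  have X_iff: "v \<in> X \<longleftrightarrow> (\<forall>i. min 0 (u $ i) \<le> v $ i \<and> v $ i \<le> max 0 (u $ i)) \<and> v \<in> ?K \<and> u - v \<in> ?G"
    for v by (auto simp: X_def mem_box_cart)
  have "closed ((\<lambda>v. u - v) -` ?G)"
    by (intro continuous_closed_vimage closed_convex_cone_hull) (auto intro!: continuous_intros)
  then have "compact X"
    unfolding X_def using closed by (intro compact_Int_closed closed_Int) auto
  moreover have "u \<in> X" using u by (auto simp: X_iff convex_cone_hull_contains_0)
  ultimately obtain v where v: "v \<in> X" and min: "\<And>x. x \<in> X \<Longrightarrow> u \<bullet> v \<le> u \<bullet> x"
    using continuous_attains_inf[of X "\<lambda>x. u \<bullet> x"]
      continuous_on_inner[OF continuous_on_const continuous_on_id] by (metis empty_iff)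
  have "v = 0"
  proof (rule ccontr)
    assume "v \<noteq> 0"
    moreover have vK: "v \<in> ?K" using v by (simp add: X_iff)
    ultimately obtain i0 where "0 < v $ i0"
      using sum_zero_hyperplane_pos_entry sub by blast
    from common_root_extractable[OF cones gen vK this] obtain i j
      where ij: "0 < v $ i" "v $ j < 0" "root_vec i j \<in> ?K" "root_vec i j \<in> extractable ?K v"
      by blast
    then obtain \<epsilon> where e: "\<epsilon> > 0" "v - \<epsilon> *\<^sub>R root_vec i j \<in> ?K" by (auto simp: extractable_def)
    \<comment> \<open>The step is cut short so that neither coordinate \<open>i\<close> nor
      \<open>j\<close> crosses zero, which keeps the new remainder in the box.\<close>
    define \<delta> where "\<delta> = min \<epsilon> (min (v $ i) (- v $ j))"
    have d: "0 < \<delta>" "\<delta> \<le> \<epsilon>" "\<delta> \<le> v $ i" "\<delta> \<le> - v $ j" using e ij by (auto simp: \<delta>_def)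
    have uij: "u $ i > 0" "u $ j < 0"
      using ij v unfolding X_iff by (smt (verit))+
    have "v - \<delta> *\<^sub>R root_vec i j \<in> X"
      unfolding X_iff
    proof (intro conjI allI)
      show "v - \<delta> *\<^sub>R root_vec i j \<in> ?K"
        using d by (intro extractable_shrink[OF K vK e(2)]) auto
      have "u - (v - \<delta> *\<^sub>R root_vec i j) = (u - v) + \<delta> *\<^sub>R root_vec i j" by simp
      also have "\<dots> \<in> ?G"
      proof (rule convex_cone_hull_add)
        show "u - v \<in> ?G" using v by (simp add: X_iff)
        show "\<delta> *\<^sub>R root_vec i j \<in> ?G"
          using d ij by (intro convex_cone_hull_mul hull_inc) auto
      qed
      finally show "u - (v - \<delta> *\<^sub>R root_vec i j) \<in> ?G" .
    next
      fix k
      have "i \<noteq> j" using ij by auto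
      moreover have "min 0 (u $ k) \<le> v $ k" "v $ k \<le> max 0 (u $ k)" using v by (auto simp: X_iff)
      ultimately show "min 0 (u $ k) \<le> (v - \<delta> *\<^sub>R root_vec i j) $ k"
        "(v - \<delta> *\<^sub>R root_vec i j) $ k \<le> max 0 (u $ k)"
        using d ij uij by (auto simp: root_vec_nth)
    qed
    \<comment> \<open>The root has positive inner product with \<open>u\<close>, so the objective
      would drop strictly.\<close>
    from min[OF this] have "\<delta> * (u $ i - u $ j) \<le> 0" by (simp add: inner_diff_right)
    then show False using d uij by (simp add: mult_le_0_iff)
  qed
  then show "u \<in> ?G" using v by (simp add: X_iff)
qed

section \<open>Normal cones of alcoved polyhedra\<close>

text \<open>Normals are taken inside the hyperplane: for \<open>M\<close> in it, the full normal
  cone contains all multiples of the all-ones vector, which roots cannot generate.\<close>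

definition normal_cone :: "(real ^ 'n) set \<Rightarrow> real ^ 'n \<Rightarrow> (real ^ 'n) set" where
  "normal_cone M m = {u \<in> sum_zero_hyperplane. \<forall>y\<in>M. u \<bullet> (y - m) \<le> 0}"

lemma sum_zero_hyperplane_inner: "sum_zero_hyperplane = {x. 1 \<bullet> x = 0}"
  by (simp add: sum_zero_hyperplane_def inner_vec_def)

lemma closed_sum_zero_hyperplane: "closed sum_zero_hyperplane"
  unfolding sum_zero_hyperplane_inner by (rule closed_hyperplane)

lemma subspace_sum_zero_hyperplane: "subspace sum_zero_hyperplane"
  unfolding sum_zero_hyperplane_inner by (rule subspace_hyperplane)

lemma root_vec_sum_zero: "root_vec i j \<in> sum_zero_hyperplane"
  unfolding sum_zero_hyperplane_inner by simp

lemma normal_cone_subset: "normal_cone M m \<subseteq> sum_zero_hyperplane"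
  by (auto simp: normal_cone_def)

lemma closed_normal_cone: "closed (normal_cone M m)"
proof -
  have "normal_cone M m = sum_zero_hyperplane \<inter> (\<Inter>y\<in>M. {u. (y - m) \<bullet> u \<le> 0})"
    by (auto simp: normal_cone_def inner_commute)
  also have "closed \<dots>"
    by (intro closed_Int closed_INT ballI closed_halfspace_le closed_sum_zero_hyperplane)
  finally show ?thesis .
qed

lemma convex_cone_normal_cone: "convex_cone (normal_cone M m)"
  using subspace_sum_zero_hyperplane
  by (auto simp: convex_cone_iff normal_cone_def inner_add_left subspace_def
      mult_nonneg_nonpos intro: add_nonpos_nonpos)

text \<open>Fixing one summand at its base point while the other varies gives one inclusion; adding
  the two inequalities gives the other.\<close>

lemma normal_cone_set_plus:
  assumes "p \<in> P" "q \<in> Q"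
  shows "normal_cone (P + Q) (p + q) = normal_cone P p \<inter> normal_cone Q q"
proof (intro equalityI subsetI)
  fix u assume u: "u \<in> normal_cone (P + Q) (p + q)"
  have "u \<bullet> (x - p) \<le> 0" if "x \<in> P" for x
  proof -
    have "x + q \<in> P + Q" using that assms by (intro set_plus_intro)
    with u have "u \<bullet> (x + q - (p + q)) \<le> 0" by (auto simp: normal_cone_def)
    then show ?thesis by simp
  qed
  moreover have "u \<bullet> (y - q) \<le> 0" if "y \<in> Q" for y
  proof -
    have "p + y \<in> P + Q" using that assms by (intro set_plus_intro)
    with u have "u \<bullet> (p + y - (p + q)) \<le> 0" by (auto simp: normal_cone_def)
    then show ?thesis by simp
  qed
  ultimately show "u \<in> normal_cone P p \<inter> normal_cone Q q"
    using u by (auto simp: normal_cone_def)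
next
  fix u assume u: "u \<in> normal_cone P p \<inter> normal_cone Q q"
  have "u \<bullet> (x + y - (p + q)) \<le> 0" if "x \<in> P" "y \<in> Q" for x y
  proof -
    have "u \<bullet> (x - p) \<le> 0" "u \<bullet> (y - q) \<le> 0" using u that by (auto simp: normal_cone_def)
    then show ?thesis by (simp add: inner_diff_right inner_add_right)
  qed
  then show "u \<in> normal_cone (P + Q) (p + q)"
    using u by (auto simp: normal_cone_def elim!: set_plus_elim)
qed

lemma root_vec_normal_cone_iff:
  "root_vec i j \<in> normal_cone M m \<longleftrightarrow> (\<forall>y\<in>M. y $ i - y $ j \<le> m $ i - m $ j)"
  by (auto simp: normal_cone_def root_vec_sum_zero inner_commute[of "root_vec i j"] algebra_simps)

text \<open>The roots of the inequalities tight at \<open>m\<close> generate: a normal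
  \<open>u\<close> outside their cone leaves a residual \<open>v\<close> along which one can move
  from \<open>m\<close> within \<open>M\<close> while increasing the product with
  \<open>u\<close>.\<close>

lemma alcoved_normal_cone_root_generated:
  fixes M :: "(real ^ 'n) set"
  assumes "alcoved M" "m \<in> M"
  shows "root_generated (normal_cone M m)"
  unfolding root_generated_def
proof
  obtain S :: "('n \<times> 'n \<times> real) set" where S: "finite S"
    and M: "M = {x \<in> sum_zero_hyperplane. \<forall>(i, j, a)\<in>S. x $ i - x $ j \<le> a}"
    using assms(1) by (auto simp: alcoved_def)
  define D where "D = {root_vec i j |i j. (i, j, m $ i - m $ j) \<in> S}"
  have D_roots: "D \<subseteq> roots" by (auto simp: D_def roots_def)
  have D_normal: "D \<subseteq> normal_cone M m"
    by (auto simp: D_def root_vec_normal_cone_iff M)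
  let ?G = "convex_cone hull D"
  have closed: "closed ?G"
    using D_roots by (intro closed_convex_cone_hull) (auto intro: finite_subset)
  fix u assume u: "u \<in> normal_cone M m"
  have "u \<in> ?G"
  proof (rule ccontr)
    assume "u \<notin> ?G"
    from closed_convex_cone_separation[OF closed convex_cone_convex_cone_hull this]
    obtain g where g: "g \<in> ?G" "\<And>x. x \<in> ?G \<Longrightarrow> (u - g) \<bullet> x \<le> 0" "0 < (u - g) \<bullet> u"
      by blast
    define v where "v = u - g"
    have "?G \<subseteq> normal_cone M m"
      using D_normal convex_cone_normal_cone by (rule hull_minimal)
    \<comment> \<open>Both \<open>u\<close> and \<open>g\<close> lie in the hyperplane, so moving
      along \<open>v\<close> does not leave it.\<close>
    then have v_H: "v \<in> sum_zero_hyperplane"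
      unfolding v_def using g(1) u normal_cone_subset[of M m]
      by (intro subspace_diff[OF subspace_sum_zero_hyperplane]) auto
    \<comment> \<open>Tight inequalities persist because \<open>v\<close> is polar to
      \<open>D\<close>, slack ones by continuity.\<close>
    have "\<forall>\<^sub>F \<epsilon> in at_right 0. (m + \<epsilon> *\<^sub>R v) $ i - (m + \<epsilon> *\<^sub>R v) $ j \<le> a"
      if "(i, j, a) \<in> S" for i j a
    proof (cases "m $ i - m $ j = a")
      case True
      then have "root_vec i j \<in> D" using that by (auto simp: D_def)
      from g(2)[OF hull_inc[OF this]] have "v $ i - v $ j \<le> 0" by (simp add: v_def)
      then have "(m + \<epsilon> *\<^sub>R v) $ i - (m + \<epsilon> *\<^sub>R v) $ j \<le> a" if "0 < \<epsilon>" for \<epsilon>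
        using True that by (simp add: algebra_simps)
      then show ?thesis by (rule eventually_mono[OF eventually_at_right_less])
    next
      case False
      then have "m $ i - m $ j < a" using that assms(2) by (auto simp: M)
      moreover have "((\<lambda>\<epsilon>. (m + \<epsilon> *\<^sub>R v) $ i - (m + \<epsilon> *\<^sub>R v) $ j) \<longlongrightarrow>
          (m + 0 *\<^sub>R v) $ i - (m + 0 *\<^sub>R v) $ j) (at_right 0)"
        by (intro tendsto_intros)
      ultimately have "\<forall>\<^sub>F \<epsilon> in at_right 0. (m + \<epsilon> *\<^sub>R v) $ i - (m + \<epsilon> *\<^sub>R v) $ j < a"
        by (intro order_tendstoD(2)) auto
      then show ?thesis by (rule eventually_mono) simp
    qed
    then have "\<forall>\<^sub>F \<epsilon> in at_right 0. \<forall>(i, j, a)\<in>S. (m + \<epsilon> *\<^sub>R v) $ i - (m + \<epsilon> *\<^sub>R v) $ j \<le> a"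
      using S by (intro eventually_ball_finite) auto
    then have "\<forall>\<^sub>F \<epsilon> in at_right (0::real). 0 < \<epsilon> \<and> m + \<epsilon> *\<^sub>R v \<in> M"
      using eventually_at_right_less[of "0::real"]
    proof eventually_elim
      case (elim \<epsilon>)
      moreover have "m + \<epsilon> *\<^sub>R v \<in> sum_zero_hyperplane"
        using v_H assms(2) subspace_sum_zero_hyperplane
        by (auto simp: M intro!: subspace_add subspace_scale)
      ultimately show ?case by (simp add: M)
    qed
    then obtain \<epsilon> where "0 < \<epsilon>" "m + \<epsilon> *\<^sub>R v \<in> M"
      using eventually_happens'[OF trivial_limit_at_right_real] by blast
    with u have "\<epsilon> * (u \<bullet> v) \<le> 0" by (force simp: normal_cone_def)
    with \<open>0 < \<epsilon>\<close> g(3) show False by (simp add: v_def inner_commute mult_le_0_iff)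
  qed
  moreover have "?G \<subseteq> convex_cone hull (normal_cone M m \<inter> roots)"
    using D_roots D_normal by (intro hull_mono) auto
  ultimately show "u \<in> convex_cone hull (normal_cone M m \<inter> roots)" by blast
qed

text \<open>If \<open>x\<close> satisfies all root inequalities valid on \<open>M\<close> and
  \<open>m\<close> is its projection, then \<open>x - m\<close> is normal at \<open>m\<close>, hence
  a combination of roots maximized over \<open>M\<close> at \<open>m\<close>. Each of them pairs
  nonpositively with \<open>x - m\<close>, which forces \<open>x = m\<close>.\<close>

lemma alcoved_if_normal_cones_root_generated:
  fixes M :: "(real ^ 'n) set"
  assumes "closed M" "convex M" "M \<noteq> {}" "M \<subseteq> sum_zero_hyperplane"
    and gen: "\<And>m. m \<in> M \<Longrightarrow> root_generated (normal_cone M m)"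
  shows "alcoved M"
proof -
  define h where "h i j = Sup ((\<lambda>y. y $ i - y $ j) ` M)" for i j
  \<comment> \<open>Only directions bounded on \<open>M\<close> enter, as \<open>Sup\<close> carries
    no information for the others.\<close>
  define S where "S = {(i, j, h i j) |i j. i \<noteq> j \<and> bdd_above ((\<lambda>y. y $ i - y $ j) ` M)}"
  have "S \<subseteq> (\<lambda>(i, j). (i, j, h i j)) ` UNIV" by (auto simp: S_def)
  then have "finite S" by (rule finite_subset) simp
  moreover have "\<forall>(i, j, a)\<in>S. i \<noteq> j" by (auto simp: S_def)
  moreover have "M = {x \<in> sum_zero_hyperplane. \<forall>(i, j, a)\<in>S. x $ i - x $ j \<le> a}"
  proof (intro equalityI subsetI)
    fix x assume "x \<in> M"
    then show "x \<in> {x \<in> sum_zero_hyperplane. \<forall>(i, j, a)\<in>S. x $ i - x $ j \<le> a}"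
      using assms(4) by (auto simp: S_def h_def intro!: cSup_upper)
  next
    fix x assume x: "x \<in> {x \<in> sum_zero_hyperplane. \<forall>(i, j, a)\<in>S. x $ i - x $ j \<le> a}"
    define m where "m = closest_point M x"
    have m: "m \<in> M" unfolding m_def using assms by (intro closest_point_in_set)
    have "x - m \<in> normal_cone M m"
      unfolding normal_cone_def
    proof (intro CollectI conjI ballI)
      show "x - m \<in> sum_zero_hyperplane"
        using x m assms(4) by (intro subspace_diff[OF subspace_sum_zero_hyperplane]) auto
    qed (unfold m_def, rule closest_point_dot[OF assms(2,1)])
    then have "x - m \<in> convex_cone hull (normal_cone M m \<inter> roots)"
      using gen[OF m] by (auto simp: root_generated_def)
    also have "\<dots> \<subseteq> {r. (x - m) \<bullet> r \<le> 0}"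
    proof (intro hull_minimal convex_cone_halfspace_le subsetI)
      fix r assume r: "r \<in> normal_cone M m \<inter> roots"
      then obtain i j where ij: "r = root_vec i j" by (auto simp: roots_def)
      with r have max: "y $ i - y $ j \<le> m $ i - m $ j" if "y \<in> M" for y
        using that by (auto simp: root_vec_normal_cone_iff)
      have "x $ i - x $ j \<le> m $ i - m $ j"
      proof (cases "i = j")
        case False
        moreover have "bdd_above ((\<lambda>y. y $ i - y $ j) ` M)" using max by (rule bdd_aboveI2)
        ultimately have "(i, j, h i j) \<in> S" by (auto simp: S_def)
        with x have "x $ i - x $ j \<le> h i j" by auto
        also have "\<dots> \<le> m $ i - m $ j"
          unfolding h_def using max assms(3) by (intro cSUP_least)
        finally show ?thesis .
      qed simp
      then show "r \<in> {r. (x - m) \<bullet> r \<le> 0}" by (simp add: ij)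
    qed
    finally have "(x - m) \<bullet> (x - m) \<le> 0" by simp
    then have "x = m" by (metis inner_gt_zero_iff not_le right_minus_eq)
    with m show "x \<in> M" by simp
  qed
  ultimately show ?thesis unfolding alcoved_def by blast
qed

section \<open>Minkowski sums of alcoved polyhedra\<close>

lemma alcoved_finite_halfspaces:
  fixes M :: "(real ^ 'n) set"
  assumes "alcoved M"
  obtains F where "finite F" "M = {x. \<forall>(g, b)\<in>F. g \<bullet> x \<le> b}"
proof -
  obtain S :: "('n \<times> 'n \<times> real) set" where S: "finite S"
    and M: "M = {x \<in> sum_zero_hyperplane. \<forall>(i, j, a)\<in>S. x $ i - x $ j \<le> a}"
    using assms by (auto simp: alcoved_def)
  \<comment> \<open>The first two half-spaces, with the all-ones vector and its negative as normals,
    cut out the hyperplane.\<close>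
  let ?F = "{(1, 0), (- 1, 0)} \<union> (\<lambda>(i, j, a). (root_vec i j, a)) ` S"
  have "M = {x. \<forall>(g, b)\<in>?F. g \<bullet> x \<le> b}"
    unfolding M sum_zero_hyperplane_inner
    by (auto simp: inner_commute[of "root_vec _ _"] ball_Un)
  then show thesis using that[of ?F] S by blast
qed

lemma alcoved_convex: "alcoved M \<Longrightarrow> convex M"
proof (erule alcoved_finite_halfspaces)
  fix F assume "M = {x. \<forall>(g, b)\<in>F. g \<bullet> x \<le> b}"
  then have "M = (\<Inter>(g, b)\<in>F. {x. g \<bullet> x \<le> b})" by auto
  then show "convex M" by (auto intro!: convex_INT convex_halfspace_le)
qed

lemma alcoved_subset: "alcoved M \<Longrightarrow> M \<subseteq> sum_zero_hyperplane"
  by (auto simp: alcoved_def)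

text \<open>The intersection of two of the normal cones is the normal cone of a pairwise sum, hence
  root-generated; \<open>root_generated_Int3\<close> then treats the triple sum.\<close>

lemma alcoved_set_plus3:
  fixes P Q R :: "(real ^ 'n) set"
  assumes "alcoved P" "alcoved Q" "alcoved R"
    and "alcoved (P + Q)" "alcoved (Q + R)" "alcoved (P + R)"
  shows "alcoved (P + Q + R)"
proof (cases "P + Q + R = {}")
  case True
  \<comment> \<open>An empty sum equals its empty summand, which is alcoved by assumption.\<close>
  then have "P = {} \<or> Q = {} \<or> R = {}" by (auto simp: set_plus_def)
  with True assms show ?thesis by metis
next
  case False
  show ?thesis
  proof (rule alcoved_if_normal_cones_root_generated)
    obtain F where F: "finite F" "P + Q = {x. \<forall>(g, b)\<in>F. g \<bullet> x \<le> b}"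
      using assms(4) by (rule alcoved_finite_halfspaces)
    obtain G where G: "finite G" "R = {x. \<forall>(g, b)\<in>G. g \<bullet> x \<le> b}"
      using assms(3) by (rule alcoved_finite_halfspaces)
    show "closed (P + Q + R)" using F G by (rule closed_sum_finite_halfspaces)
    show "convex (P + Q + R)"
      using assms by (intro convex_set_plus alcoved_convex)
    show "P + Q + R \<subseteq> sum_zero_hyperplane"
      using alcoved_subset[OF assms(3)] alcoved_subset[OF assms(4)] subspace_sum_zero_hyperplane
      by (auto elim!: set_plus_elim[of _ "P + Q"] intro: subspace_add)
    fix m assume "m \<in> P + Q + R"
    then obtain p q r where pqr: "p \<in> P" "q \<in> Q" "r \<in> R" and m: "m = p + q + r"
      by (metis set_plus_elim)
    have "normal_cone (P + Q + R) m = normal_cone P p \<inter> normal_cone Q q \<inter> normal_cone R r"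
      using pqr by (simp add: m normal_cone_set_plus set_plus_intro)
    also have "root_generated \<dots>"
    proof (intro root_generated_Int3 convex_cone_normal_cone closed_normal_cone normal_cone_subset)
      show "root_generated (normal_cone P p \<inter> normal_cone Q q)"
        "root_generated (normal_cone Q q \<inter> normal_cone R r)"
        "root_generated (normal_cone P p \<inter> normal_cone R r)"
        using alcoved_normal_cone_root_generated[OF assms(4), of "p + q"]
          alcoved_normal_cone_root_generated[OF assms(5), of "q + r"]
          alcoved_normal_cone_root_generated[OF assms(6), of "p + r"] pqr
        by (simp_all add: normal_cone_set_plus set_plus_intro)
    qed
    finally show "root_generated (normal_cone (P + Q + R) m)" .
  qed (rule False)
qed

text \<open>The inequalities with bound \<open>0\<close> for all ordered pairs make the coordinates
  equal, and the hyperplane makes them vanish.\<close>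

lemma alcoved_0: "alcoved (0 :: (real ^ 'n) set)"
proof -
  let ?S = "(\<lambda>(i, j). (i, j, 0)) ` {(i, j). i \<noteq> j} :: ('n \<times> 'n \<times> real) set"
  have "x = 0" if x: "x \<in> sum_zero_hyperplane" "\<forall>(i, j, a)\<in>?S. x $ i - x $ j \<le> a"
    for x :: "real ^ 'n"
  proof -
    have "x $ i \<le> x $ j" for i j using x(2) by (cases "i = j") auto
    then have "x $ i = x $ j" for i j by (meson order_antisym)
    then obtain c where c: "\<And>i. x $ i = c" by metis
    with x(1) have "c = 0" by (simp add: sum_zero_hyperplane_def)
    with c show ?thesis by (simp add: vec_eq_iff)
  qed
  then have "0 = {x \<in> sum_zero_hyperplane. \<forall>(i, j, a)\<in>?S. x $ i - x $ j \<le> a}"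
    by (auto simp: set_zero sum_zero_hyperplane_def)
  moreover have "finite ?S" by simp
  moreover have "\<forall>(i, j, a)\<in>?S. i \<noteq> j" by auto
  ultimately show ?thesis unfolding alcoved_def by blast
qed

text \<open>The accumulator \<open>R\<close> absorbs one summand at a time; by the three-summand
  case it stays compatible with every summand still to come.\<close>

lemma alcoved_set_plus_sum:
  fixes P :: "'i \<Rightarrow> (real ^ 'n) set"
  assumes "finite I" "alcoved R" "\<And>i. i \<in> I \<Longrightarrow> alcoved (R + P i)"
    and "\<And>i. i \<in> I \<Longrightarrow> alcoved (P i)"
    and "\<And>i j. i \<in> I \<Longrightarrow> j \<in> I \<Longrightarrow> i \<noteq> j \<Longrightarrow> alcoved (P i + P j)"
  shows "alcoved (R + (\<Sum>i\<in>I. P i))"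
  using assms
proof (induction I arbitrary: R rule: finite_induct)
  case empty
  then show ?case by simp
next
  case (insert a I)
  have "alcoved (R + P a + P i)" if "i \<in> I" for i
    using insert.prems insert.hyps that by (intro alcoved_set_plus3) auto
  then have "alcoved (R + P a + (\<Sum>i\<in>I. P i))"
    using insert.prems by (intro insert.IH) auto
  then show ?case using insert.hyps by (simp add: add.assoc)
qed

theorem theorem2p8:
  fixes P :: "nat \<Rightarrow> (real ^ 'n) set" and k :: nat
  assumes "\<And>i. i \<in> {1..k} \<Longrightarrow> alcoved (P i)"
    and "\<And>i j. i \<in> {1..k} \<Longrightarrow> j \<in> {1..k} \<Longrightarrow> i \<noteq> j \<Longrightarrow> compatible (P i) (P j)"
  shows "alcoved (\<Sum>i\<in>{1..k}. P i)"
proof -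
  \<comment> \<open>Starting from the neutral accumulator reduces its compatibility conditions to
    alcovedness of each \<open>P i\<close>, and covers \<open>k = 0\<close>.\<close>
  have "alcoved (0 + (\<Sum>i\<in>{1..k}. P i))"
    using assms by (intro alcoved_set_plus_sum alcoved_0) (auto simp: compatible_def)
  then show ?thesis by simp
qed

end
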